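(* Consider a stationary Markov chain $\{X_i\}_{i\geq 0}$ on the state space $\mathcal{X}=\mathbb{R}$ with invariant distribution $\pi\sim\mathcal{N}(0,1)$ and transition kernel $$P(x,B)=\lambda\,\mathbb{I}(x\in B)+(1-\lambda)\pi(B),\quad \forall x\in\mathcal{X},\ \forall B\subseteq\mathcal{X}.$$ There exists no finite constant $\widetilde{\alpha}$ such that the sums $\sum_{i=1}^n X_i$, $n\geq 1$, are sub-Gaussian with variance proxy $n\widetilde{\alpha}$.
   Context: Here $\lambda\in[0,1]$ is the operator norm of the transition kernel $P$, viewed as the operator $Ph(x)=\int h(y)P(x,dy)$, acting on the mean-zero functions that are square-integrable with respect to $\pi$; for the kernel in the claim this norm equals the coefficient $\lambda$ appearing in it. The sets $B$ range over the Borel sigma-algebra of $\mathbb{R}$, and $\mathbb{I}$ is the indicator. A Markov chain is stationary if its initial distribution is the invariant distribution $\pi$. A random variable $Z$ is sub-Gaussian with variance proxy $\sigma^2$ if it has a finite mean $\mathbb{E}Z$ and $\mathbb{E}[e^{t(Z-\mathbb{E}Z)}]\leq\exp(\sigma^2t^2/2)$ for all $t\in\mathbb{R}$.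
   Formalization: The case λ = 0 is excluded (0 < λ ≤ 1 is assumed): for λ = 0 the chain is i.i.d. N(0,1), so the sums are N(0,n) and sub-Gaussian with variance proxy n, and the claim fails. *)

theory Defs
  imports "HOL-Probability.Probability"
begin

definition history_sigma :: "'a measure \<Rightarrow> 'b measure \<Rightarrow> (nat \<Rightarrow> 'a \<Rightarrow> 'b) \<Rightarrow> nat \<Rightarrow> 'a measure" where
  "history_sigma M S X n = sigma (space M) {X i -` A \<inter> space M | i A. i \<le> n \<and> A \<in> sets S}"

definition markov_chain ::
    "'a measure \<Rightarrow> 'b measure \<Rightarrow> ('b \<Rightarrow> 'b measure) \<Rightarrow> (nat \<Rightarrow> 'a \<Rightarrow> 'b) \<Rightarrow> bool" where
  "markov_chain M S P X \<longleftrightarrow>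
     prob_space M \<and> P \<in> S \<rightarrow>\<^sub>M prob_algebra S \<and> (\<forall>n. X n \<in> M \<rightarrow>\<^sub>M S) \<and>
     (\<forall>n. \<forall>B\<in>sets S. AE \<omega> in M.
        real_cond_exp M (history_sigma M S X n) (\<lambda>\<omega>'. indicator B (X (Suc n) \<omega>')) \<omega>
          = measure (P (X n \<omega>)) B)"

definition invariant_distribution :: "'b measure \<Rightarrow> ('b \<Rightarrow> 'b measure) \<Rightarrow> 'b measure \<Rightarrow> bool" where
  "invariant_distribution S P \<pi> \<longleftrightarrow> \<pi> \<in> space (prob_algebra S) \<and> \<pi> \<bind> P = \<pi>"

definition stationary_markov_chain ::
    "'a measure \<Rightarrow> 'b measure \<Rightarrow> ('b \<Rightarrow> 'b measure) \<Rightarrow> 'b measure \<Rightarrow> (nat \<Rightarrow> 'a \<Rightarrow> 'b) \<Rightarrow> bool" where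
  "stationary_markov_chain M S P \<pi> X \<longleftrightarrow>
     markov_chain M S P X \<and> invariant_distribution S P \<pi> \<and> distr M S (X 0) = \<pi>"

definition std_normal :: "real measure" where
  "std_normal = density lborel (\<lambda>x. ennreal (std_normal_density x))"

definition lazy_normal_kernel :: "real \<Rightarrow> real \<Rightarrow> real measure" where
  "lazy_normal_kernel lam x =
     measure_of UNIV (sets borel)
       (\<lambda>B. ennreal lam * indicator B x + ennreal (1 - lam) * emeasure std_normal B)"

(* The parameter v plays the role of sigma^2; integrability of the exponential is required
   because the Bochner integral of a non-integrable function is 0. *)
definition sub_gaussian :: "'a measure \<Rightarrow> ('a \<Rightarrow> real) \<Rightarrow> real \<Rightarrow> bool" where
  "sub_gaussian M Z v \<longleftrightarrow>
     integrable M Z \<and>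
     (\<forall>t. integrable M (\<lambda>\<omega>. exp (t * (Z \<omega> - integral\<^sup>L M Z))) \<and>
          integral\<^sup>L M (\<lambda>\<omega>. exp (t * (Z \<omega> - integral\<^sup>L M Z))) \<le> exp (v * t\<^sup>2 / 2))"

lemma prob_space_std_normal: "prob_space std_normal"
  unfolding std_normal_def by (rule prob_space_normal_density) simp

lemma sets_std_normal [simp, measurable_cong]: "sets std_normal = sets borel"
  by (simp add: std_normal_def)

lemma space_std_normal [simp]: "space std_normal = UNIV"
  by (simp add: std_normal_def)

lemma sets_lazy_normal_kernel [simp]: "sets (lazy_normal_kernel lam x) = sets borel"
  unfolding lazy_normal_kernel_def using sets.sets_measure_of_eq[of "borel :: real measure"] by simp

lemma space_lazy_normal_kernel [simp]: "space (lazy_normal_kernel lam x) = UNIV"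
  unfolding lazy_normal_kernel_def using sets.space_measure_of_eq[of "borel :: real measure"] by simp

lemma emeasure_lazy_normal_kernel:
  assumes B: "B \<in> sets borel"
  shows "emeasure (lazy_normal_kernel lam x) B
           = ennreal lam * indicator B x + ennreal (1 - lam) * emeasure std_normal B"
proof (rule emeasure_measure_of[OF lazy_normal_kernel_def])
  let ?L = "lazy_normal_kernel lam x"
  show "positive (sets ?L)
     (\<lambda>B. ennreal lam * indicator B x + ennreal (1 - lam) * emeasure std_normal B)"
    by (simp add: positive_def)
  show "countably_additive (sets ?L)
     (\<lambda>B. ennreal lam * indicator B x + ennreal (1 - lam) * emeasure std_normal B)"
  proof (rule countably_additiveI)
    fix A :: "nat \<Rightarrow> real set"
    assume A: "range A \<subseteq> sets ?L" "disjoint_family A"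
    have 1: "(\<Sum>i. indicator (A i) x) = (indicator (\<Union>i. A i) x :: ennreal)"
      using A(2) by (rule suminf_indicator)
    have 2: "(\<Sum>i. emeasure std_normal (A i)) = emeasure std_normal (\<Union>i. A i)"
      using A by (intro suminf_emeasure) auto
    show "(\<Sum>i. ennreal lam * indicator (A i) x + ennreal (1 - lam) * emeasure std_normal (A i))
       = ennreal lam * indicator (\<Union>i. A i) x + ennreal (1 - lam) * emeasure std_normal (\<Union>i. A i)"
      by (simp add: suminf_add[symmetric] 1 2)
  qed
qed (use B in auto)

lemma measure_lazy_normal_kernel:
  assumes "0 \<le> lam" "lam \<le> 1" and B: "B \<in> sets borel"
  shows "measure (lazy_normal_kernel lam x) B = lam * indicator B x + (1 - lam) * measure std_normal B"
proof -
  interpret prob_space std_normal by (rule prob_space_std_normal)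
  have "emeasure (lazy_normal_kernel lam x) B
          = ennreal (lam * indicator B x + (1 - lam) * measure std_normal B)"
    using assms by (simp add: emeasure_lazy_normal_kernel emeasure_eq_measure indicator_def
        ennreal_mult ennreal_plus)
  then show ?thesis
    by (rule measure_eq_emeasure_eq_ennreal[rotated]) (use assms in simp)
qed

lemma lazy_normal_kernel_measurable:
  assumes "0 \<le> lam" "lam \<le> 1"
  shows "lazy_normal_kernel lam \<in> borel \<rightarrow>\<^sub>M prob_algebra borel"
proof (rule measurable_prob_algebraI)
  interpret prob_space std_normal by (rule prob_space_std_normal)
  have e: "emeasure std_normal UNIV = 1"
    using emeasure_space_1 by simp
  show p: "prob_space (lazy_normal_kernel lam x)" for x
    by (rule prob_spaceI)
       (use assms in \<open>simp add: emeasure_lazy_normal_kernel e ennreal_plus[symmetric] del: ennreal_plus\<close>)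
  show "lazy_normal_kernel lam \<in> borel \<rightarrow>\<^sub>M subprob_algebra borel"
    by (rule measurable_subprob_algebra)
       (use p in \<open>auto simp: emeasure_lazy_normal_kernel intro: prob_space_imp_subprob_space\<close>)
qed

lemma invariant_std_normal:
  assumes "0 \<le> lam" "lam \<le> 1"
  shows "invariant_distribution borel (lazy_normal_kernel lam) std_normal"
  unfolding invariant_distribution_def
proof
  interpret prob_space std_normal by (rule prob_space_std_normal)
  show sp: "std_normal \<in> space (prob_algebra borel)"
    by (simp add: space_prob_algebra prob_space_std_normal)
  have k: "lazy_normal_kernel lam \<in> std_normal \<rightarrow>\<^sub>M subprob_algebra borel"
    using measurable_prob_algebraD[OF lazy_normal_kernel_measurable[OF assms]]
    by (simp add: measurable_def)
  show "std_normal \<bind> lazy_normal_kernel lam = std_normal"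
  proof (rule measure_eqI)
    show s: "sets (std_normal \<bind> lazy_normal_kernel lam) = sets std_normal"
      by (simp add: sets_bind[where N = borel])
    fix B assume "B \<in> sets (std_normal \<bind> lazy_normal_kernel lam)"
    then have B: "B \<in> sets borel" using s by simp
    have "emeasure (std_normal \<bind> lazy_normal_kernel lam) B
        = (\<integral>\<^sup>+x. ennreal lam * indicator B x + ennreal (1 - lam) * emeasure std_normal B \<partial>std_normal)"
      using B by (simp add: emeasure_bind[OF _ k] emeasure_lazy_normal_kernel)
    also have "\<dots> = (ennreal lam + ennreal (1 - lam)) * emeasure std_normal B"
      using B emeasure_space_1
      by (simp add: nn_integral_add nn_integral_cmult_indicator distrib_right)
    also have "\<dots> = emeasure std_normal B"
      using assms by (simp add: ennreal_plus[symmetric] del: ennreal_plus)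
    finally show "emeasure (std_normal \<bind> lazy_normal_kernel lam) B = emeasure std_normal B" .
  qed
qed

end

theory Submission
  imports Defs
begin

text \<open>
  With probability at least \<open>lam ^ n * \<pi>(B)\<close> the chain starts in \<open>B\<close> and stays there for
  \<open>n\<close> steps, so the sum is at least \<open>n * a\<close> with probability bounded below by \<open>lam ^ n\<close> times
  a positive constant, for every \<open>a\<close>. A variance proxy \<open>n * \<alpha>\<close> would force, by Chernoff's
  bound at \<open>t = 1\<close>, this probability to be at most \<open>exp (n * (\<alpha> / 2 - a))\<close>, which is impossible
  for large \<open>n\<close> once \<open>a > \<alpha> / 2 - ln lam\<close>. Multiplying the bounds for the upper and the lower
  tail cancels the mean of the sum, which therefore need not be computed.
\<close>

lemma sets_history_sigma:
  "sets (history_sigma M S X n)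
     = sigma_sets (space M) {X i -` A \<inter> space M | i A. i \<le> n \<and> A \<in> sets S}"
  unfolding history_sigma_def by (rule sets_measure_of) auto

lemma space_history_sigma: "space (history_sigma M S X n) = space M"
  unfolding history_sigma_def by (rule space_measure_of) auto

lemma subalgebra_history_sigma:
  assumes "\<And>i. X i \<in> M \<rightarrow>\<^sub>M S"
  shows "subalgebra M (history_sigma M S X n)"
  unfolding subalgebra_def space_history_sigma sets_history_sigma
  using assms by (auto intro!: sets.sigma_sets_subset measurable_sets)

text \<open>Measurability in the history, not just in \<open>M\<close>, is what allows integrating a
  conditional expectation over this event.\<close>

lemma stay_in_sets_history_sigma:
  assumes "B \<in> sets S"
  shows "{\<omega>\<in>space M. \<forall>i\<le>n. X i \<omega> \<in> B} \<in> sets (history_sigma M S X n)"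
proof -
  have *: "{\<omega>\<in>space M. \<forall>i\<le>n. X i \<omega> \<in> B} = (\<Inter>i\<in>{..n}. X i -` B \<inter> space M)"
    by auto
  have "X i -` B \<inter> space M \<in> sets (history_sigma M S X n)" if "i \<le> n" for i
    unfolding sets_history_sigma using that assms by (intro sigma_sets.Basic) auto
  then show ?thesis
    unfolding * by (intro sets.finite_INT) auto
qed

text \<open>Induction on \<open>n\<close>: given the history up to time \<open>n\<close>, a chain
  that is still in \<open>B\<close> remains there for one more step with probability at least
  \<open>c\<close>, so each transition costs at most a factor \<open>c\<close>.\<close>

lemma markov_chain_stay_prob:
  assumes mc: "markov_chain M S P X" and B: "B \<in> sets S"
    and c: "0 \<le> c" "\<And>x. x \<in> B \<Longrightarrow> c \<le> measure (P x) B"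
  shows "c ^ n * measure M {\<omega>\<in>space M. X 0 \<omega> \<in> B}
           \<le> measure M {\<omega>\<in>space M. \<forall>i\<le>n. X i \<omega> \<in> B}"
proof (induction n)
  case 0
  then show ?case by simp
next
  case (Suc n)
  interpret prob_space M using mc by (simp add: markov_chain_def)
  have X [measurable]: "X i \<in> M \<rightarrow>\<^sub>M S" for i
    using mc by (simp add: markov_chain_def)
  note [measurable] = B
  let ?F = "history_sigma M S X n"
  let ?A = "\<lambda>n. {\<omega>\<in>space M. \<forall>i\<le>n. X i \<omega> \<in> B}"
  let ?f = "\<lambda>\<omega>. indicator B (X (Suc n) \<omega>) :: real"
  have sub: "subalgebra M ?F" by (rule subalgebra_history_sigma[OF X])
  interpret F: finite_measure_subalgebra M ?F
    by unfold_locales (rule sub)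
  have AF: "?A n \<in> sets ?F" by (rule stay_in_sets_history_sigma[OF B])
  have A [measurable]: "?A m \<in> sets M" for m by measurable
  have f: "integrable M ?f"
    by (rule integrable_const_bound[where B = 1]) auto
  have ae: "AE \<omega> in M. real_cond_exp M ?F ?f \<omega> = measure (P (X n \<omega>)) B"
    using mc B by (simp add: markov_chain_def)
  have "c ^ Suc n * prob {\<omega>\<in>space M. X 0 \<omega> \<in> B} \<le> c * prob (?A n)"
    using mult_left_mono[OF Suc.IH c(1)] by (simp add: mult.assoc)
  also have "\<dots> = (\<integral>\<omega>. indicator (?A n) \<omega> * c \<partial>M)"
    by simp
  also have "\<dots> \<le> (\<integral>\<omega>. indicator (?A n) \<omega> * real_cond_exp M ?F ?f \<omega> \<partial>M)"
  proof (rule integral_mono_AE)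
    show "integrable M (\<lambda>\<omega>. indicator (?A n) \<omega> * real_cond_exp M ?F ?f \<omega>)"
      using integrable_mult_indicator[OF A F.real_cond_exp_int(1)[OF f]] by simp
    show "AE \<omega> in M. indicator (?A n) \<omega> * c \<le> indicator (?A n) \<omega> * real_cond_exp M ?F ?f \<omega>"
      using ae by eventually_elim (auto simp: indicator_def intro!: c(2))
  qed (simp add: integrable_real_indicator less_top[symmetric])
  \<comment> \<open>Defining property of the conditional expectation, applied to an event of the
    history.\<close>
  also have "\<dots> = (\<integral>\<omega>. indicator (?A n) \<omega> * ?f \<omega> \<partial>M)"
    using F.real_cond_exp_intA[OF f AF] by (simp add: set_lebesgue_integral_def)
  also have "\<dots> = (\<integral>\<omega>. indicator (?A (Suc n)) \<omega> \<partial>M)"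
    by (intro Bochner_Integration.integral_cong) (auto simp: indicator_def le_Suc_eq)
  also have "\<dots> = prob (?A (Suc n))"
    by simp
  finally show ?case .
qed

text \<open>The kernel holds the chain at its current point with weight \<open>lam\<close>, which
  bounds the one-step staying probability below. The rate \<open>lam\<close> is the same for every
  \<open>B\<close>, however far out in the tail; \<open>B\<close> affects only the constant
  factor.\<close>

lemma lazy_normal_stay_prob:
  assumes lam: "0 \<le> lam" "lam \<le> 1"
    and st: "stationary_markov_chain M borel (lazy_normal_kernel lam) std_normal X"
    and B: "B \<in> sets borel"
  shows "lam ^ n * measure std_normal B \<le> measure M {\<omega>\<in>space M. \<forall>i\<le>n. X i \<omega> \<in> B}"
proof -
  have mc: "markov_chain M borel (lazy_normal_kernel lam) X"
    and d: "distr M borel (X 0) = std_normal"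
    using st by (simp_all add: stationary_markov_chain_def)
  have X: "X 0 \<in> M \<rightarrow>\<^sub>M borel" using mc by (simp add: markov_chain_def)
  have "measure std_normal B = measure M {\<omega>\<in>space M. X 0 \<omega> \<in> B}"
    unfolding d[symmetric] using X B
    by (simp add: measure_distr vimage_def Int_def conj_commute)
  moreover have "lam \<le> measure (lazy_normal_kernel lam x) B" if "x \<in> B" for x
    using that lam B by (simp add: measure_lazy_normal_kernel)
  ultimately show ?thesis
    using markov_chain_stay_prob[OF mc B lam(1)] by simp
qed

text \<open>The density vanishes nowhere, so every null set of \<open>std_normal\<close> is Lebesgue
  null.\<close>

lemma measure_std_normal_pos:
  assumes B: "B \<in> sets borel" and pos: "emeasure lborel B \<noteq> 0"
  shows "0 < measure std_normal B"
proof -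
  interpret prob_space std_normal by (rule prob_space_std_normal)
  have "emeasure std_normal B \<noteq> 0"
  proof
    assume "emeasure std_normal B = 0"
    then have "B \<in> null_sets (density lborel (\<lambda>x. ennreal (std_normal_density x)))"
      using B by (simp add: null_sets_def std_normal_def)
    then have "AE x in lborel. x \<in> B \<longrightarrow> ennreal (std_normal_density x) = 0"
      by (subst (asm) null_sets_density_iff) auto
    then have "AE x in lborel. x \<notin> B"
    proof eventually_elim
      case (elim x)
      moreover have "0 < std_normal_density x" by (rule normal_density_pos) simp
      ultimately show ?case by auto
    qed
    then show False
      using B pos by (simp add: AE_iff_measurable[of B])
  qed
  then show ?thesis
    by (simp add: emeasure_eq_measure zero_less_measure_iff)
qed

text \<open>The moment bound ranges over all real \<open>t\<close> and is even in \<open>t\<close>.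
  This reduces the lower tail to the upper one.\<close>

lemma sub_gaussian_uminus:
  assumes "sub_gaussian M Z v"
  shows "sub_gaussian M (\<lambda>\<omega>. - Z \<omega>) v"
proof -
  have eq: "t * (- Z \<omega> - (\<integral>\<omega>. - Z \<omega> \<partial>M)) = (- t) * (Z \<omega> - (\<integral>\<omega>. Z \<omega> \<partial>M))" for t \<omega>
    by (simp add: algebra_simps)
  show ?thesis
    using assms unfolding sub_gaussian_def eq by (metis integrable_minus power2_minus)
qed

text \<open>Chernoff's bound at \<open>t = 1\<close>. It is stated for any event on which
  \<open>c\<close> bounds \<open>Z\<close> from below, so that it applies directly to the event of
  staying in an interval.\<close>

lemma sub_gaussian_tail:
  assumes "prob_space M" and "sub_gaussian M Z v"
    and A: "A \<in> sets M" "\<And>\<omega>. \<omega> \<in> A \<Longrightarrow> c \<le> Z \<omega>"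
  shows "exp (c - integral\<^sup>L M Z) * measure M A \<le> exp (v / 2)"
proof -
  interpret prob_space M by fact
  let ?g = "\<lambda>\<omega>. exp (Z \<omega> - integral\<^sup>L M Z)"
  have g: "integrable M ?g" "integral\<^sup>L M ?g \<le> exp (v / 2)"
    using assms(2) unfolding sub_gaussian_def by (auto dest!: spec[of _ 1])
  have "exp (c - integral\<^sup>L M Z) * prob A
          = (\<integral>\<omega>. indicator A \<omega> * exp (c - integral\<^sup>L M Z) \<partial>M)"
    using A(1) sets.sets_into_space[OF A(1)] by (simp add: Int_absorb2)
  also have "\<dots> \<le> integral\<^sup>L M ?g"
  proof (rule integral_mono)
    show "integrable M (\<lambda>\<omega>. indicator A \<omega> * exp (c - integral\<^sup>L M Z))"
      using A(1) by (simp add: integrable_real_indicator less_top[symmetric])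
  qed (use A g(1) in \<open>auto simp: indicator_def\<close>)
  finally show ?thesis using g(2) by simp
qed

theorem theorem2p4:
  fixes lam :: real and M :: "'a measure" and X :: "nat \<Rightarrow> 'a \<Rightarrow> real"
  assumes "0 < lam" and "lam \<le> 1"
    and "stationary_markov_chain M borel (lazy_normal_kernel lam) std_normal X"
  shows "\<not> (\<exists>\<alpha>::real. \<forall>n\<ge>1. sub_gaussian M (\<lambda>\<omega>. \<Sum>i=1..n. X i \<omega>) (real n * \<alpha>))"
proof
  assume "\<exists>\<alpha>::real. \<forall>n\<ge>1. sub_gaussian M (\<lambda>\<omega>. \<Sum>i=1..n. X i \<omega>) (real n * \<alpha>)"
  then obtain \<alpha> :: real
    where sg: "\<And>n. 1 \<le> n \<Longrightarrow> sub_gaussian M (\<lambda>\<omega>. \<Sum>i=1..n. X i \<omega>) (real n * \<alpha>)"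
    by blast
  have M: "prob_space M" and X [measurable]: "\<And>i. X i \<in> M \<rightarrow>\<^sub>M borel"
    using assms(3) by (simp_all add: stationary_markov_chain_def markov_chain_def)
  \<comment> \<open>Chosen so that \<open>2 * (a + ln lam) = \<alpha> + 1\<close>: the product of
    the two tail bounds then exceeds what the variance proxy allows by the factor
    \<open>exp (real n)\<close>, up to the constant \<open>q\<close>.\<close>
  define a where "a = \<alpha> / 2 - ln lam + 1 / 2"
  let ?U = "{a..a + 1}" and ?L = "{- a - 1..- a}"
  define q where "q = measure std_normal ?U * measure std_normal ?L"
  have q: "0 < q"
    unfolding q_def by (intro mult_pos_pos measure_std_normal_pos) simp_all
  have bound: "exp (real n) * q \<le> 1" if n: "1 \<le> n" for n
  proof -
    let ?S = "\<lambda>\<omega>. \<Sum>i=1..n. X i \<omega>"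
    let ?m = "integral\<^sup>L M ?S"
    \<comment> \<open>The event covers times \<open>0\<close> to \<open>n\<close>, hence
      \<open>n\<close> transitions and the factor \<open>lam ^ n\<close>; the sum uses only times
      \<open>1\<close> to \<open>n\<close>.\<close>
    let ?A = "\<lambda>B. {\<omega>\<in>space M. \<forall>i\<le>n. X i \<omega> \<in> B}"
    have A: "?A B \<in> sets M" if [measurable]: "B \<in> sets borel" for B
      by measurable
    have stay: "lam ^ n * measure std_normal B \<le> measure M (?A B)" if "B \<in> sets borel" for B
      using assms that by (intro lazy_normal_stay_prob) auto
    have "exp (real n * a - ?m) * measure M (?A ?U) \<le> exp (real n * \<alpha> / 2)"
    proof (rule sub_gaussian_tail[OF M sg[OF n]])
      fix \<omega> assume "\<omega> \<in> ?A ?U"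
      then show "real n * a \<le> ?S \<omega>"
        using sum_bounded_below[of "{1..n}" a "\<lambda>i. X i \<omega>"] by simp
    qed (simp add: A)
    then have U: "exp (real n * a - ?m) * (lam ^ n * measure std_normal ?U) \<le> exp (real n * \<alpha> / 2)"
      by (rule order_trans[rotated]) (intro mult_left_mono stay; simp)
    have "exp (real n * a - integral\<^sup>L M (\<lambda>\<omega>. - ?S \<omega>)) * measure M (?A ?L)
            \<le> exp (real n * \<alpha> / 2)"
    proof (rule sub_gaussian_tail[OF M sub_gaussian_uminus[OF sg[OF n]]])
      fix \<omega> assume "\<omega> \<in> ?A ?L"
      then show "real n * a \<le> - ?S \<omega>"
        using sum_bounded_above[of "{1..n}" "\<lambda>i. X i \<omega>" "- a"] by simp
    qed (simp add: A)
    then have "exp (real n * a - integral\<^sup>L M (\<lambda>\<omega>. - ?S \<omega>)) * (lam ^ n * measure std_normal ?L)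
            \<le> exp (real n * \<alpha> / 2)"
      by (rule order_trans[rotated]) (intro mult_left_mono stay; simp)
    \<comment> \<open>The mean now appears with the sign opposite to that in
      \<open>U\<close>.\<close>
    then have L: "exp (real n * a + ?m) * (lam ^ n * measure std_normal ?L) \<le> exp (real n * \<alpha> / 2)"
      by (simp only: Bochner_Integration.integral_minus diff_minus_eq_add)
    have lam: "lam ^ n = exp (real n * ln lam)"
      using assms(1) by (simp add: exp_of_nat_mult)
    have "exp (real n * \<alpha>) * (exp (real n) * q)
        = exp (real n * a - ?m) * (lam ^ n * measure std_normal ?U)
            * (exp (real n * a + ?m) * (lam ^ n * measure std_normal ?L))"
    proof -
      have "real n * \<alpha> + real n
          = (real n * a - ?m) + real n * ln lam + ((real n * a + ?m) + real n * ln lam)"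
        by (simp add: a_def field_simps)
      then have "exp (real n * \<alpha>) * exp (real n)
          = exp (real n * a - ?m) * lam ^ n * (exp (real n * a + ?m) * lam ^ n)"
        unfolding lam by (simp only: exp_add[symmetric])
      then show ?thesis
        unfolding q_def mult.assoc[symmetric, of "exp (real n * \<alpha>)"] by (simp only: ac_simps)
    qed
    also have "\<dots> \<le> exp (real n * \<alpha> / 2) * exp (real n * \<alpha> / 2)"
      by (rule mult_mono[OF U L]) (use assms(1) in auto)
    also have "\<dots> = exp (real n * \<alpha>) * 1"
      by (simp flip: exp_add)
    finally show ?thesis
      by (rule mult_left_le_imp_le) simp
  qed
  obtain n where n: "1 / q < real n"
    using reals_Archimedean2 by blast
  with q have "1 \<le> n" by (cases n) (auto simp: field_simps)
  \<comment> \<open>Linear growth already suffices, since \<open>exp (real n)\<close> is at least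
    \<open>1 + real n\<close>.\<close>
  have "1 < real n * q" using n q by (simp add: field_simps)
  also have "\<dots> \<le> exp (real n) * q"
    using exp_ge_add_one_self[of "real n"] q by (intro mult_right_mono) linarith+
  also have "\<dots> \<le> 1" by (rule bound[OF \<open>1 \<le> n\<close>])
  finally show False by simp
qed

end
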